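(* Let $1\le r\le s$, let $A\in\mathbb{C}_r^{m\times n}$ and $B\in\mathbb{C}_s^{m\times n}$, and let $\sigma_1\ge\dots\ge\sigma_r>0$ and $\widehat\sigma_1\ge\dots\ge\widehat\sigma_s>0$ be the nonzero singular values of $A$ and $B$, respectively. Then $$|\mathrm{Tr}\,B^*A|\le\frac{\sum_{j=1}^r\sigma_j\widehat\sigma_j}{\left(\sum_{j=1}^r\sigma_j^2\right)^{1/2}\left(\sum_{j=1}^s\widehat\sigma_j^2\right)^{1/2}}\;\|A\|_F\|B\|_F .$$ Moreover the coefficient of $\|A\|_F\|B\|_F$ is optimal: for given $m,n$ and given $\sigma_1\ge\dots\ge\sigma_r>0$, $\widehat\sigma_1\ge\dots\ge\widehat\sigma_s>0$ with $s\le\min(m,n)$, it cannot be replaced by any smaller number so that the inequality still holds for all $A\in\mathbb{C}_r^{m\times n}$, $B\in\mathbb{C}_s^{m\times n}$ with these nonzero singular values.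
   Context: $\mathbb{C}^{m\times n}_r$ denotes the set of complex $m\times n$ matrices of rank $r$; $\|\cdot\|_F$ is the Frobenius norm; $\mathrm{Tr}$ is the trace and $B^*$ the conjugate transpose of $B$. *)

theory Defs
  imports
    Complex_Main
    "Jordan_Normal_Form.Char_Poly"
    "Jordan_Normal_Form.Schur_Decomposition"
    "Jordan_Normal_Form.DL_Rank"
begin

definition mat_trace :: "complex mat \<Rightarrow> complex" where
  "mat_trace A = (\<Sum>i<dim_row A. A $$ (i, i))"

definition frobenius_norm :: "complex mat \<Rightarrow> real" where
  "frobenius_norm A = sqrt (\<Sum>i<dim_row A. \<Sum>j<dim_col A. (cmod (A $$ (i, j)))\<^sup>2)"

definition rank_mats :: "nat \<Rightarrow> nat \<Rightarrow> nat \<Rightarrow> complex mat set" where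
  "rank_mats m n r = {A \<in> carrier_mat m n. vec_space.rank m A = r}"

text \<open>
  The singular values of \<open>A\<close> are the square roots of the eigenvalues of \<open>A\<^sup>* A\<close>.
  As \<open>proots\<close> returns the roots of a polynomial with their multiplicities, an eigenvalue occurs
  as often as its (algebraic, hence also geometric) multiplicity. These eigenvalues are
  nonnegative reals, so \<open>Re\<close> only changes the type. The list is in decreasing order.
\<close>
definition nonzero_singular_values :: "complex mat \<Rightarrow> real list" where
  "nonzero_singular_values A =
     rev (sorted_list_of_multiset
       (filter_mset (\<lambda>x. x \<noteq> 0)
         (image_mset (\<lambda>z. sqrt (Re z)) (proots (char_poly (mat_adjoint A * A))))))"

text \<open>The \<open>j\<close>-th largest nonzero singular value, counted from \<open>j = 1\<close>.\<close>
definition nonzero_singular_value :: "complex mat \<Rightarrow> nat \<Rightarrow> real" where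
  "nonzero_singular_value A j = nonzero_singular_values A ! (j - 1)"

definition trace_coeff :: "nat \<Rightarrow> nat \<Rightarrow> (nat \<Rightarrow> real) \<Rightarrow> (nat \<Rightarrow> real) \<Rightarrow> real" where
  "trace_coeff r s \<sigma> \<tau> =
     (\<Sum>j=1..r. \<sigma> j * \<tau> j) / (sqrt (\<Sum>j=1..r. (\<sigma> j)\<^sup>2) * sqrt (\<Sum>j=1..s. (\<tau> j)\<^sup>2))"

end

theory Submission
  imports Defs
begin

text \<open>
  Let \<open>A = \<Sum> \<sigma> i \<cdot> u i \<cdot> (v i)\<^sup>*\<close> and \<open>B = \<Sum> \<tau> j \<cdot> x j \<cdot> (y j)\<^sup>*\<close> be thin singular value decompositions
  (\<open>ex_thin_svd\<close>), with \<open>r\<close> and \<open>s\<close> terms. The squared Frobenius norm of \<open>A\<close> is the trace of \<open>A\<^sup>* A\<close>, hence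
  the sum of the squares of the \<open>\<sigma> i\<close> (\<open>frobenius_norm_thin_svd\<close>), and likewise for \<open>B\<close>. The denominator
  of the coefficient therefore cancels against the two norms, and the claim is von Neumann's trace
  inequality \<open>|Tr B\<^sup>* A| \<le> \<Sum> \<sigma> i * \<tau> i\<close> (\<open>von_neumann_trace_inequality\<close>).

  Expanding the trace gives \<open>\<Sum> \<sigma> i * \<tau> j * \<langle>u i, x j\<rangle> * \<langle>y j, v i\<rangle>\<close>. The product of the two inner products
  is bounded by the mean of their squared moduli, and by Bessel's inequality these means form an
  array with row and column sums at most one. For decreasing \<open>\<sigma>\<close> and \<open>\<tau>\<close> a sum weighted by such an array
  is largest when the ones of the array sit on its diagonal (\<open>doubly_substochastic_sum_le\<close>).

  The decomposition comes from diagonalizing the Hermitian matrix \<open>A\<^sup>* A\<close> by a unitary matrix with the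
  eigenvalues in decreasing order (\<open>hermitian_unitarily_diagonalizable\<close>). The number of nonzero
  eigenvalues is the rank (\<open>rank_orthogonal_columns\<close>), which identifies the \<open>r\<close> terms of the
  decomposition with the list of nonzero singular values.

  Optimality holds because rectangular diagonal matrices with the given singular values have all
  singular vectors aligned and turn the inequality into an equality.
\<close>

section \<open>Adjoint matrices and orthonormal families\<close>

lemma mat_adjoint_dim [simp]:
  "dim_row (mat_adjoint A) = dim_col A" "dim_col (mat_adjoint A) = dim_row A"
  unfolding mat_adjoint_def by auto

lemma mat_adjoint_carrier [simp]:
  "A \<in> carrier_mat m n \<Longrightarrow> mat_adjoint A \<in> carrier_mat n m"
  by (intro carrier_matI) auto

lemma index_mat_adjoint:
  fixes A :: "complex mat"
  assumes "i < dim_col A" "j < dim_row A"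
  shows "mat_adjoint A $$ (i, j) = cnj (A $$ (j, i))"
  using assms unfolding mat_adjoint_def mat_of_rows_def by simp

lemma mat_adjoint_mult:
  fixes A B :: "complex mat"
  assumes "A \<in> carrier_mat m n" "B \<in> carrier_mat n k"
  shows "mat_adjoint (A * B) = mat_adjoint B * mat_adjoint A"
  by (rule eq_matI, use assms in \<open>auto simp: index_mat_adjoint scalar_prod_def mult.commute intro!: sum.cong\<close>)

lemma mat_adjoint_adjoint [simp]:
  fixes A :: "complex mat"
  shows "mat_adjoint (mat_adjoint A) = A"
  by (rule eq_matI) (auto simp: index_mat_adjoint)

text \<open>
  Vectors are functions of which only the first \<open>N\<close> values matter. Families of vectors then need no
  carrier side conditions, and matrix products turn into double sums that can be exchanged freely.
\<close>
definition cinner :: "nat \<Rightarrow> (nat \<Rightarrow> complex) \<Rightarrow> (nat \<Rightarrow> complex) \<Rightarrow> complex" where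
  "cinner N f g = (\<Sum>p<N. f p * cnj (g p))"

definition orthonormal :: "nat \<Rightarrow> nat \<Rightarrow> (nat \<Rightarrow> nat \<Rightarrow> complex) \<Rightarrow> bool" where
  "orthonormal N k u \<longleftrightarrow> (\<forall>i<k. \<forall>j<k. cinner N (u i) (u j) = of_bool (i = j))"

lemma cinner_self: "cinner N f f = of_real (\<Sum>p<N. (cmod (f p))\<^sup>2)"
  by (simp only: cinner_def of_real_sum complex_norm_square)

lemma cnj_cinner: "cnj (cinner N f g) = cinner N g f"
  by (simp add: cinner_def mult.commute)

lemma index_adjoint_mult:
  fixes A B :: "complex mat"
  assumes "A \<in> carrier_mat m n" "B \<in> carrier_mat m k" "i < n" "j < k"
  shows "(mat_adjoint A * B) $$ (i, j) = cinner m (\<lambda>p. B $$ (p, j)) (\<lambda>p. A $$ (p, i))"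
  using assms
  by (auto simp: cinner_def scalar_prod_def index_mat_adjoint mult.commute lessThan_atLeast0
           intro!: sum.cong)

text \<open>
  Subtracting from \<open>f\<close> its orthogonal projection onto the span of the family leaves a vector whose
  squared norm is the difference of the two sides.
\<close>
lemma bessel:
  assumes "orthonormal N k u"
  shows "(\<Sum>i<k. (cmod (cinner N f (u i)))\<^sup>2) \<le> (\<Sum>p<N. (cmod (f p))\<^sup>2)"
proof -
  define c where "c i = cinner N f (u i)" for i
  define g where "g p = f p - (\<Sum>i<k. c i * u i p)" for p
  have expand: "cinner N g h = cinner N f h - (\<Sum>i<k. c i * cinner N (u i) h)" for h
  proof -
    have "cinner N g h = cinner N f h - (\<Sum>p<N. \<Sum>i<k. c i * (u i p * cnj (h p)))"
      by (simp add: cinner_def g_def algebra_simps sum_subtractf sum_distrib_left)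
    also have "(\<Sum>p<N. \<Sum>i<k. c i * (u i p * cnj (h p))) = (\<Sum>i<k. c i * cinner N (u i) h)"
      by (subst sum.swap) (simp add: cinner_def sum_distrib_left)
    finally show ?thesis .
  qed
  have orth: "cinner N g (u j) = 0" if "j < k" for j
  proof -
    have "(\<Sum>i<k. c i * cinner N (u i) (u j)) = (\<Sum>i<k. if i = j then c j else 0)"
      using assms that by (intro sum.cong) (auto simp: orthonormal_def)
    also have "\<dots> = c j" using that by simp
    finally show ?thesis by (simp add: expand c_def)
  qed
  have "cinner N g g = cnj (cinner N f g - (\<Sum>i<k. c i * cinner N (u i) g))"
    by (simp only: expand[symmetric] cnj_cinner)
  also have "\<dots> = cinner N g f - (\<Sum>i<k. cnj (c i) * cinner N g (u i))"
    by (simp add: cnj_cinner)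
  also have "\<dots> = cinner N g f" by (simp add: orth)
  also have "\<dots> = cinner N f f - (\<Sum>i<k. c i * cnj (c i))"
    by (simp add: expand c_def cnj_cinner)
  also have "(\<Sum>i<k. c i * cnj (c i)) = of_real (\<Sum>i<k. (cmod (c i))\<^sup>2)"
    by (simp only: of_real_sum complex_norm_square)
  finally have "(\<Sum>p<N. (cmod (g p))\<^sup>2) = (\<Sum>p<N. (cmod (f p))\<^sup>2) - (\<Sum>i<k. (cmod (c i))\<^sup>2)"
    unfolding cinner_self of_real_diff[symmetric] of_real_eq_iff .
  moreover have "0 \<le> (\<Sum>p<N. (cmod (g p))\<^sup>2)" by (simp add: sum_nonneg)
  ultimately show ?thesis by (simp add: c_def)
qed

section \<open>Sums weighted by a doubly substochastic array\<close>

text \<open>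
  Summation by parts: \<open>\<Sum> \<sigma> i * (b i - a i)\<close> is a combination of the partial sums of \<open>b - a\<close> whose
  coefficients \<open>\<sigma> i - \<sigma> (i + 1)\<close>, and \<open>\<sigma> (r - 1)\<close> for the last one, are nonnegative.
\<close>
lemma abel_sum_le:
  fixes \<sigma> a b :: "nat \<Rightarrow> real"
  assumes anti: "antimono_on {..<r} \<sigma>" and nonneg: "\<And>i. i < r \<Longrightarrow> 0 \<le> \<sigma> i"
    and partial: "\<And>k. k \<le> r \<Longrightarrow> (\<Sum>i<k. a i) \<le> (\<Sum>i<k. b i)"
  shows "(\<Sum>i<r. \<sigma> i * a i) \<le> (\<Sum>i<r. \<sigma> i * b i)"
proof -
  define x where "x i = b i - a i" for i
  have S: "0 \<le> (\<Sum>i<k. x i)" if "k \<le> r" for k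
    using partial[OF that] by (simp add: x_def sum_subtractf)
  \<comment> \<open>The inductive form: replacing all weights by the smallest one can only decrease the sum.\<close>
  have step: "Suc k \<le> r \<Longrightarrow> \<sigma> k * (\<Sum>i<Suc k. x i) \<le> (\<Sum>i<Suc k. \<sigma> i * x i)" for k
  proof (induction k)
    case 0
    then show ?case by simp
  next
    case (Suc k)
    have "\<sigma> (Suc k) \<le> \<sigma> k"
      using anti Suc.prems by (auto simp: monotone_on_def)
    then have "\<sigma> (Suc k) * (\<Sum>i<Suc k. x i) \<le> \<sigma> k * (\<Sum>i<Suc k. x i)"
      using S[of "Suc k"] Suc.prems by (intro mult_right_mono) auto
    also have "\<dots> \<le> (\<Sum>i<Suc k. \<sigma> i * x i)" using Suc by simp
    finally show ?case by (simp add: distrib_left)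
  qed
  have "0 \<le> (\<Sum>i<r. \<sigma> i * x i)"
  proof (cases r)
    case (Suc k)
    have "0 \<le> \<sigma> k * (\<Sum>i<Suc k. x i)"
      using S[of r] nonneg[of k] Suc by (intro mult_nonneg_nonneg) auto
    then show ?thesis using step[of k] Suc by simp
  qed simp
  then show ?thesis by (simp add: x_def algebra_simps sum_subtractf)
qed

text \<open>
  A total mass of \<open>k\<close> with at most one unit in each position yields most when it fills the first \<open>k\<close>
  positions, because these carry the largest values of \<open>\<tau>\<close>.
\<close>
lemma capped_weights_le:
  fixes \<tau> c :: "nat \<Rightarrow> real"
  assumes anti: "antimono_on {..<s} \<tau>" and nonneg: "\<And>j. j < s \<Longrightarrow> 0 \<le> \<tau> j"
    and c: "\<And>j. j < s \<Longrightarrow> 0 \<le> c j" "\<And>j. j < s \<Longrightarrow> c j \<le> 1"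
    and total: "(\<Sum>j<s. c j) \<le> real k" and "k \<le> s"
  shows "(\<Sum>j<s. \<tau> j * c j) \<le> (\<Sum>j<k. \<tau> j)"
proof (cases k)
  case 0
  then have "(\<Sum>j<s. c j) = 0" using total c(1) by (auto intro!: antisym sum_nonneg)
  then have "\<forall>j\<in>{..<s}. c j = 0" using c(1) by (subst (asm) sum_nonneg_eq_0_iff) auto
  then show ?thesis using 0 by simp
next
  case (Suc l)
  have l: "l < s" using Suc \<open>k \<le> s\<close> by simp
  define e where "e j = (of_bool (j < k) :: real)" for j
  have sum_e: "(\<Sum>j<s. f j * e j) = (\<Sum>j<k. f j)" for f
  proof -
    have "(\<Sum>j<k. f j) = (\<Sum>j<k. f j * e j)" by (simp add: e_def)
    also have "\<dots> = (\<Sum>j<s. f j * e j)"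
      using \<open>k \<le> s\<close> by (intro sum.mono_neutral_left) (auto simp: e_def)
    finally show ?thesis by simp
  qed
  \<comment> \<open>With \<open>e\<close> the indicator of the first \<open>k\<close> positions, \<open>c - e\<close> is nonpositive there and nonnegative
      beyond, so \<open>\<tau> j\<close> may be replaced by the threshold value \<open>\<tau> l\<close>, where \<open>l\<close> is the last of them.\<close>
  have "(\<Sum>j<s. \<tau> j * (c j - e j)) \<le> (\<Sum>j<s. \<tau> l * (c j - e j))"
  proof (rule sum_mono)
    fix j assume "j \<in> {..<s}"
    then have j: "j < s" by simp
    show "\<tau> j * (c j - e j) \<le> \<tau> l * (c j - e j)"
    proof (cases "j < k")
      case True
      then have "\<tau> l \<le> \<tau> j" using anti l j Suc by (auto simp: monotone_on_def)
      then show ?thesis using True c(2)[OF j] by (intro mult_right_mono_neg) (auto simp: e_def)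
    next
      case False
      then have "\<tau> j \<le> \<tau> l" using anti l j Suc by (auto simp: monotone_on_def)
      then show ?thesis using False c(1)[OF j] by (intro mult_right_mono) (auto simp: e_def)
    qed
  qed
  also have "\<dots> = \<tau> l * ((\<Sum>j<s. c j) - real k)"
    using sum_e[of "\<lambda>_. 1"] by (simp add: sum_distrib_left[symmetric] sum_subtractf)
  also have "\<dots> \<le> 0" using nonneg[OF l] total by (intro mult_nonneg_nonpos) auto
  finally show ?thesis by (simp add: right_diff_distrib sum_subtractf sum_e)
qed

text \<open>
  A rearrangement inequality: arrays with row and column sums at most one generalize permutation
  matrices, and pairing the two decreasing sequences in order is the best choice. The first \<open>k\<close> rows
  put weights of at most one on each \<open>\<tau> j\<close>, of total at most \<open>k\<close>, so \<open>capped_weights_le\<close> bounds the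
  partial sums over rows, and summation by parts brings in \<open>\<sigma>\<close>.
\<close>
lemma doubly_substochastic_sum_le:
  fixes \<sigma> \<tau> :: "nat \<Rightarrow> real" and p :: "nat \<Rightarrow> nat \<Rightarrow> real"
  assumes \<sigma>: "antimono_on {..<r} \<sigma>" "\<And>i. i < r \<Longrightarrow> 0 \<le> \<sigma> i"
    and \<tau>: "antimono_on {..<s} \<tau>" "\<And>j. j < s \<Longrightarrow> 0 \<le> \<tau> j"
    and p: "\<And>i j. 0 \<le> p i j"
    and rows: "\<And>i. i < r \<Longrightarrow> (\<Sum>j<s. p i j) \<le> 1"
    and cols: "\<And>j. j < s \<Longrightarrow> (\<Sum>i<r. p i j) \<le> 1"
    and "r \<le> s"
  shows "(\<Sum>i<r. \<Sum>j<s. \<sigma> i * \<tau> j * p i j) \<le> (\<Sum>i<r. \<sigma> i * \<tau> i)"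
proof -
  have "(\<Sum>i<k. \<Sum>j<s. \<tau> j * p i j) \<le> (\<Sum>i<k. \<tau> i)" if "k \<le> r" for k
  proof -
    have "(\<Sum>i<k. \<Sum>j<s. \<tau> j * p i j) = (\<Sum>j<s. \<tau> j * (\<Sum>i<k. p i j))"
      by (subst sum.swap) (simp add: sum_distrib_left)
    also have "\<dots> \<le> (\<Sum>j<k. \<tau> j)"
    proof (rule capped_weights_le[OF \<tau>])
      show "(\<Sum>i<k. p i j) \<le> 1" if "j < s" for j
      proof -
        have "(\<Sum>i<k. p i j) \<le> (\<Sum>i<r. p i j)"
          using \<open>k \<le> r\<close> p by (intro sum_mono2) auto
        then show ?thesis using cols[OF that] by simp
      qed
      have "(\<Sum>j<s. \<Sum>i<k. p i j) = (\<Sum>i<k. \<Sum>j<s. p i j)" by (rule sum.swap)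
      also have "\<dots> \<le> (\<Sum>i<k. 1)" using rows \<open>k \<le> r\<close> by (intro sum_mono) auto
      finally show "(\<Sum>j<s. \<Sum>i<k. p i j) \<le> real k" by simp
    qed (use p \<open>k \<le> r\<close> \<open>r \<le> s\<close> in \<open>auto intro: sum_nonneg\<close>)
    finally show ?thesis .
  qed
  from abel_sum_le[OF \<sigma> this]
  show ?thesis by (simp add: sum_distrib_left mult.assoc)
qed

section \<open>Unitary diagonalization of Hermitian matrices\<close>

definition diagonal :: "nat \<Rightarrow> (nat \<Rightarrow> complex) \<Rightarrow> complex mat" where
  "diagonal n f = mat n n (\<lambda>(i, j). if i = j then f i else 0)"

text \<open>
  Gram--Schmidt applied to a basis that starts with \<open>v\<close> gives orthogonal columns, the first one being
  \<open>v\<close> itself; they are then normalized.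
\<close>
lemma unitary_completion:
  fixes v :: "complex vec"
  assumes v: "v \<in> carrier_vec n" "v \<noteq> 0\<^sub>v n"
  shows "\<exists>W\<in>carrier_mat n n. \<exists>c. mat_adjoint W * W = 1\<^sub>m n \<and> col W 0 = c \<cdot>\<^sub>v v"
proof -
  interpret cof_vec_space n "TYPE(complex)" .
  define b where "b = basis_completion v"
  define ws where "ws = gram_schmidt n b"
  note b = basis_completion[OF v, folded b_def]
  have n: "0 < n" using v by (cases n) auto
  then obtain vs where bv: "b = v # vs" using b(6,7) by (cases b) auto
  from gram_schmidt_result[OF b(2,4,5) ws_def]
  have orth: "corthogonal ws" and ws: "set ws \<subseteq> carrier_vec n" and len: "length ws = n"
    by (auto simp: b(6))
  have "hd ws = v" using gram_schmidt_hd[OF v(1), of vs] by (simp add: ws_def bv)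
  then have ws0: "ws ! 0 = v" using len n by (metis hd_conv_nth length_0_conv less_irrefl)
  have dim: "dim_vec (ws ! i) = n" if "i < n" for i
    using ws len that by (metis carrier_vecD nth_mem subsetD)
  define f where "f i p = ws ! i $ p" for i p
  have cf: "ws ! i \<bullet>c ws ! j = cinner n (f i) (f j)" if "i < n" "j < n" for i j
    using that dim by (simp add: scalar_prod_def cinner_def f_def lessThan_atLeast0)
  define N where "N i = sqrt (\<Sum>p<n. (cmod (f i p))\<^sup>2)" for i
  have NN: "complex_of_real (N i) * complex_of_real (N i) = cinner n (f i) (f i)" for i
    unfolding cinner_self of_real_mult[symmetric] N_def by (simp add: sum_nonneg)
  have fi: "cinner n (f i) (f j) = 0 \<longleftrightarrow> i \<noteq> j" if "i < n" "j < n" for i j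
    using corthogonalD[OF orth, of i j] that len cf by simp
  define W where "W = mat n n (\<lambda>(p, i). f i p / of_real (N i))"
  have W: "W \<in> carrier_mat n n" by (simp add: W_def)
  have WW: "mat_adjoint W * W = 1\<^sub>m n"
  proof (rule eq_matI)
    fix i j assume "i < dim_row (1\<^sub>m n :: complex mat)" "j < dim_col (1\<^sub>m n :: complex mat)"
    then have ij: "i < n" "j < n" by auto
    have "(mat_adjoint W * W) $$ (i, j) = cinner n (\<lambda>p. W $$ (p, j)) (\<lambda>p. W $$ (p, i))"
      by (rule index_adjoint_mult[OF W W ij])
    also have "\<dots> = (\<Sum>p<n. f j p * cnj (f i p) / (of_real (N j) * of_real (N i)))"
      unfolding cinner_def using ij by (intro sum.cong) (simp_all add: W_def)
    also have "\<dots> = cinner n (f j) (f i) / (of_real (N j) * of_real (N i))"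
      by (simp add: cinner_def sum_divide_distrib)
    also have "\<dots> = 1\<^sub>m n $$ (i, j)"
      using fi[OF ij(2,1)] fi[OF ij(1,1)] ij by (auto simp: NN)
    finally show "(mat_adjoint W * W) $$ (i, j) = 1\<^sub>m n $$ (i, j)" .
  qed (use W in auto)
  have "col W 0 = (1 / of_real (N 0)) \<cdot>\<^sub>v v"
    by (rule eq_vecI) (use n v ws0 in \<open>auto simp: W_def f_def\<close>)
  with W WW show ?thesis by blast
qed

lemma block_diagonal_mult:
  fixes X Y E F :: "'a :: semiring_1 mat"
  assumes "E \<in> carrier_mat l l" "F \<in> carrier_mat l l" "X \<in> carrier_mat k k" "Y \<in> carrier_mat k k"
  shows "four_block_mat E (0\<^sub>m l k) (0\<^sub>m k l) X * four_block_mat F (0\<^sub>m l k) (0\<^sub>m k l) Y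
       = four_block_mat (E * F) (0\<^sub>m l k) (0\<^sub>m k l) (X * Y)"
  using mult_four_block_mat[OF assms(1) zero_carrier_mat zero_carrier_mat assms(3)
      assms(2) zero_carrier_mat zero_carrier_mat assms(4)] assms by simp

text \<open>
  Schur's deflation. A unitary matrix \<open>W\<close> whose first column is an eigenvector for \<open>e\<close> turns \<open>A\<close> into
  \<open>A' = W\<^sup>* A W\<close> with first column \<open>(e, 0, \<dots>, 0)\<close>. As \<open>A'\<close> is Hermitian, its first row vanishes off the
  diagonal too, and the remaining block is Hermitian with the remaining eigenvalues. The eigenvalues
  appear on the diagonal in the prescribed order \<open>es\<close>, which allows them to be sorted beforehand.
\<close>
lemma hermitian_unitarily_diagonalizable:
  assumes "A \<in> carrier_mat n n" "mat_adjoint A = A"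
    and "char_poly A = (\<Prod>e\<leftarrow>es. [:- e, 1:])"
  shows "\<exists>V\<in>carrier_mat n n. mat_adjoint V * V = 1\<^sub>m n \<and>
           mat_adjoint V * A * V = diagonal n (\<lambda>i. es ! i)"
  using assms
proof (induction es arbitrary: n A)
  case Nil
  with degree_monic_char_poly[of A n] have "n = 0" by simp
  show ?case
    by (rule bexI[of _ "1\<^sub>m 0"]) (auto simp: \<open>n = 0\<close> diagonal_def intro!: eq_matI)
next
  case (Cons e es n A)
  note A = Cons.prems(1) and herm = Cons.prems(2)
  define k where "k = n - 1"
  have cp: "char_poly A = [:- e, 1:] * (\<Prod>e\<leftarrow>es. [:- e, 1:])" using Cons.prems(3) by simp
  then have ev: "eigenvalue A e" unfolding eigenvalue_root_char_poly[OF A] by simp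
  then obtain v where v: "v \<in> carrier_vec n" "v \<noteq> 0\<^sub>v n" and Av: "A *\<^sub>v v = e \<cdot>\<^sub>v v"
    using A by (auto simp: eigenvalue_def eigenvector_def)
  have n: "n = Suc k" using v by (cases n) (auto simp: k_def)
  obtain W c where W: "W \<in> carrier_mat n n" and WW: "mat_adjoint W * W = 1\<^sub>m n"
    and W0: "col W 0 = c \<cdot>\<^sub>v v"
    using unitary_completion[OF v] by blast
  have W': "mat_adjoint W \<in> carrier_mat n n" using W by simp
  have WW': "W * mat_adjoint W = 1\<^sub>m n" by (rule mat_mult_left_right_inverse[OF W' W WW])
  define A' where "A' = mat_adjoint W * A * W"
  have A': "A' \<in> carrier_mat n n"
    unfolding A'_def by (intro mult_carrier_mat[of _ n n] W W' A)
  have AW: "A * W \<in> carrier_mat n n" using A W by simp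
  have A'2: "A' = mat_adjoint W * (A * W)" unfolding A'_def by (rule assoc_mult_mat[OF W' A W])
  have herm': "mat_adjoint A' = A'"
    unfolding A'2 mat_adjoint_mult[OF W' AW] mat_adjoint_mult[OF A W] mat_adjoint_adjoint herm
    using assoc_mult_mat[OF W' A W] .
  have eigcol: "col (A * W) 0 = e \<cdot>\<^sub>v col W 0"
  proof -
    have "col (A * W) 0 = A *\<^sub>v col W 0" by (rule col_mult2[OF A W]) (simp add: n)
    also have "\<dots> = c \<cdot>\<^sub>v (A *\<^sub>v v)" unfolding W0 using A v by (simp add: mult_mat_vec)
    also have "\<dots> = e \<cdot>\<^sub>v col W 0" unfolding Av W0 by (simp add: smult_smult_assoc mult.commute)
    finally show ?thesis .
  qed
  have col0: "A' $$ (i, 0) = (if i = 0 then e else 0)" if "i < n" for i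
  proof -
    have AWp: "(A * W) $$ (p, 0) = e * W $$ (p, 0)" if "p < n" for p
      using arg_cong[OF eigcol, of "\<lambda>x. x $ p"] that A W n by simp
    have "A' $$ (i, 0) = cinner n (\<lambda>p. (A * W) $$ (p, 0)) (\<lambda>p. W $$ (p, i))"
      unfolding A'2 using that n by (intro index_adjoint_mult[OF W AW]) auto
    also have "\<dots> = e * cinner n (\<lambda>p. W $$ (p, 0)) (\<lambda>p. W $$ (p, i))"
      by (simp add: cinner_def sum_distrib_left AWp mult.assoc del: index_mult_mat)
    also have "\<dots> = e * (mat_adjoint W * W) $$ (i, 0)"
      using index_adjoint_mult[OF W W that, of 0] n by simp
    finally show ?thesis using that n by (simp add: WW)
  qed
  have row0: "A' $$ (0, j) = (if j = 0 then e else 0)" if "j < n" for j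
  proof (cases "j = 0")
    case False
    have "A' $$ (0, j) = mat_adjoint A' $$ (0, j)" by (simp add: herm')
    also have "\<dots> = cnj (A' $$ (j, 0))" using A' that n by (intro index_mat_adjoint) auto
    finally show ?thesis using col0[OF that] False by simp
  qed (use col0[OF that] in simp)
  define A3 where "A3 = mat k k (\<lambda>(i, j). A' $$ (Suc i, Suc j))"
  have A3: "A3 \<in> carrier_mat k k" by (simp add: A3_def)
  let ?E = "mat 1 1 (\<lambda>_. e)" and ?O = "0\<^sub>m 1 k" and ?O' = "0\<^sub>m k 1"
  have blk: "A' = four_block_mat ?E ?O ?O' A3"
  proof (rule eq_matI)
    fix i j
    assume "i < dim_row (four_block_mat ?E ?O ?O' A3)" "j < dim_col (four_block_mat ?E ?O ?O' A3)"
    then have "i < n" "j < n" using A3 n by auto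
    then show "A' $$ (i, j) = four_block_mat ?E ?O ?O' A3 $$ (i, j)"
      using A3 n col0[of i] row0[of j] by (cases i; cases j) (auto simp: A3_def)
  qed (use A' A3 n in auto)
  have herm3: "mat_adjoint A3 = A3"
  proof (rule eq_matI)
    fix i j assume "i < dim_row A3" "j < dim_col A3"
    then have ij: "i < k" "j < k" using A3 by auto
    have "mat_adjoint A3 $$ (i, j) = cnj (A' $$ (Suc j, Suc i))"
      using ij A3 by (subst index_mat_adjoint) (auto simp: A3_def)
    also have "\<dots> = mat_adjoint A' $$ (Suc i, Suc j)"
      using ij A' n by (subst index_mat_adjoint) auto
    finally show "mat_adjoint A3 $$ (i, j) = A3 $$ (i, j)" using ij by (simp add: herm' A3_def)
  qed (use A3 in auto)
  have "similar_mat_wit A' A (mat_adjoint W) W"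
    by (rule similar_mat_witI[OF WW WW' A'_def A' A W' W])
  then have "char_poly A' = char_poly A"
    by (intro char_poly_similar) (auto simp: similar_mat_def)
  moreover have "char_poly A' = char_poly ?E * char_poly A3"
    unfolding blk by (rule char_poly_four_block_zeros_col[OF _ _ A3]) auto
  moreover have "char_poly ?E = [:- e, 1:]"
    by (simp add: char_poly_defs det_def sign_def)
  ultimately have "char_poly A3 = (\<Prod>e\<leftarrow>es. [:- e, 1:])"
    unfolding cp by (metis mult_cancel_left pCons_eq_0_iff zero_neq_one)
  from Cons.IH[OF A3 herm3 this] obtain V3 where V3: "V3 \<in> carrier_mat k k"
    and VV3: "mat_adjoint V3 * V3 = 1\<^sub>m k"
    and D3: "mat_adjoint V3 * A3 * V3 = diagonal k (\<lambda>i. es ! i)" by blast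
  have V3': "mat_adjoint V3 \<in> carrier_mat k k" using V3 by simp
  define K where "K = four_block_mat (1\<^sub>m 1) ?O ?O' V3"
  have K: "K \<in> carrier_mat n n" using V3 n by (auto simp: K_def)
  have K': "mat_adjoint K \<in> carrier_mat n n" using K by simp
  have adjK: "mat_adjoint K = four_block_mat (1\<^sub>m 1) ?O ?O' (mat_adjoint V3)"
  proof (rule eq_matI)
    fix i j
    assume "i < dim_row (four_block_mat (1\<^sub>m 1) ?O ?O' (mat_adjoint V3))"
      "j < dim_col (four_block_mat (1\<^sub>m 1) ?O ?O' (mat_adjoint V3))"
    then have ij: "i < n" "j < n" using V3 n by auto
    then show "mat_adjoint K $$ (i, j) =
        four_block_mat (1\<^sub>m 1) ?O ?O' (mat_adjoint V3) $$ (i, j)"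
      using V3 K n by (subst index_mat_adjoint) (auto simp: K_def index_mat_adjoint)
  qed (use V3 K n in auto)
  have one_mat_block: "four_block_mat (1\<^sub>m 1) ?O ?O' (1\<^sub>m k) = (1\<^sub>m n :: complex mat)"
    by (rule eq_matI) (auto simp: n)
  have KK: "mat_adjoint K * K = 1\<^sub>m n"
    unfolding adjK unfolding K_def
    using block_diagonal_mult[OF one_carrier_mat one_carrier_mat V3' V3] VV3 n
    by (simp add: one_mat_block)
  have "A' * K = four_block_mat ?E ?O ?O' (A3 * V3)"
    unfolding blk K_def
    using block_diagonal_mult[OF _ one_carrier_mat A3 V3, of ?E] by simp
  then have "mat_adjoint K * (A' * K) = four_block_mat ?E ?O ?O' (mat_adjoint V3 * (A3 * V3))"
    unfolding adjK using block_diagonal_mult[OF one_carrier_mat _ V3', of ?E _ "A3 * V3"] A3 V3 by simp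
  also have "mat_adjoint V3 * (A3 * V3) = diagonal k (\<lambda>i. es ! i)"
    using D3 assoc_mult_mat[OF V3' A3 V3] by simp
  also have "four_block_mat ?E ?O ?O' (diagonal k (\<lambda>i. es ! i)) = diagonal n (\<lambda>i. (e # es) ! i)"
    by (rule eq_matI) (auto simp: diagonal_def n nth_Cons')
  finally have KAK: "mat_adjoint K * (A' * K) = diagonal n (\<lambda>i. (e # es) ! i)" .
  define V where "V = W * K"
  have V: "V \<in> carrier_mat n n" using W K by (simp add: V_def)
  have adjV: "mat_adjoint V = mat_adjoint K * mat_adjoint W"
    unfolding V_def by (rule mat_adjoint_mult[OF W K])
  have WV: "mat_adjoint W * V = K"
  proof -
    have "mat_adjoint W * V = (mat_adjoint W * W) * K" unfolding V_def using assoc_mult_mat[OF W' W K] by simp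
    then show ?thesis using WW K by simp
  qed
  have "mat_adjoint V * V = mat_adjoint K * (mat_adjoint W * V)"
    unfolding adjV by (rule assoc_mult_mat[OF K' W' V])
  then have VV: "mat_adjoint V * V = 1\<^sub>m n" by (simp add: WV KK)
  have AV: "A * V \<in> carrier_mat n n" using A V by simp
  have "A' * K = mat_adjoint W * (A * V)"
    unfolding A'2 V_def using assoc_mult_mat[OF W' AW K] assoc_mult_mat[OF A W K] by simp
  moreover have "mat_adjoint V * A * V = mat_adjoint K * (mat_adjoint W * (A * V))"
    using assoc_mult_mat[OF mat_adjoint_carrier[OF V] A V] assoc_mult_mat[OF K' W' AV]
    by (simp add: adjV)
  ultimately have "mat_adjoint V * A * V = diagonal n (\<lambda>i. (e # es) ! i)" using KAK by simp
  with V VV show ?case by blast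
qed

section \<open>Singular values and rank\<close>

text \<open>
  Recognizes the singular values from a factorization of the characteristic polynomial of \<open>A\<^sup>* A\<close>.
  The sorted eigenvalues produced by diagonalization and the explicit ones of a rectangular diagonal
  matrix both enter through it.
\<close>
lemma nonzero_singular_values_eqI:
  assumes cp: "char_poly (mat_adjoint A * A) = (\<Prod>i\<leftarrow>[0..<n]. [:- of_real ((d i)\<^sup>2), 1:])"
    and anti: "antimono_on {..<n} d"
    and pos: "\<And>i. i < k \<Longrightarrow> 0 < d i" and zero: "\<And>i. k \<le> i \<Longrightarrow> i < n \<Longrightarrow> d i = 0"
    and "k \<le> n"
  shows "nonzero_singular_values A = map d [0..<k]"
proof -
  have "proots (\<Prod>a\<leftarrow>xs. [:- a, 1:]) = mset xs" for xs :: "complex list"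
  proof (induction xs)
    case (Cons a xs)
    have nz: "(\<Prod>a\<leftarrow>xs. [:- a, 1:]) \<noteq> 0" by (auto simp: prod_list_zero_iff)
    have "proots ([:- a, 1:] * (\<Prod>a\<leftarrow>xs. [:- a, 1:])) = {#a#} + mset xs"
      by (subst proots_mult[OF _ nz]) (simp_all add: Cons)
    then show ?case by simp
  qed simp
  from this[of "map (\<lambda>i. of_real ((d i)\<^sup>2)) [0..<n]"]
  have "proots (char_poly (mat_adjoint A * A)) = mset (map (\<lambda>i. of_real ((d i)\<^sup>2)) [0..<n])"
    by (simp add: cp comp_def)
  then have "image_mset (\<lambda>z. sqrt (Re z)) (proots (char_poly (mat_adjoint A * A)))
      = mset (map (\<lambda>i. \<bar>d i\<bar>) [0..<n])"
    by (simp add: multiset.map_comp comp_def del: mset_map flip: mset_map)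
  also have "filter_mset (\<lambda>x. x \<noteq> 0) \<dots> = mset (map d [0..<k])"
  proof -
    have "[0..<n] = [0..<k] @ [k..<n]" using \<open>k \<le> n\<close> by (metis le_add_diff_inverse upt_add_eq_append zero_le)
    moreover have "filter (\<lambda>x. x \<noteq> 0) (map (\<lambda>i. \<bar>d i\<bar>) [0..<k]) = map d [0..<k]"
      using pos by (subst filter_True) (force intro: map_cong)+
    moreover have "filter (\<lambda>x. x \<noteq> 0) (map (\<lambda>i. \<bar>d i\<bar>) [k..<n]) = []"
      using zero by (auto simp: filter_empty_conv)
    ultimately show ?thesis by (simp del: mset_map map_map filter_map flip: mset_filter)
  qed
  finally have "nonzero_singular_values A = rev (sort (map d [0..<k]))"
    by (simp only: nonzero_singular_values_def sorted_list_of_multiset_mset)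
  also have "sort (map d [0..<k]) = rev (map d [0..<k])"
  proof (rule properties_for_sort)
    show "sorted (rev (map d [0..<k]))"
      unfolding sorted_rev_iff_nth_mono using anti \<open>k \<le> n\<close> by (auto simp: monotone_on_def)
  qed simp
  finally show ?thesis by simp
qed

text \<open>
  The diagonal entries of \<open>V\<^sup>* (A\<^sup>* A) V = (A V)\<^sup>* (A V)\<close> are squared norms of the columns of \<open>A V\<close>.
  Hence the eigenvalues of \<open>A\<^sup>* A\<close> are nonnegative reals, and listing them in decreasing order before
  diagonalizing makes \<open>d\<close> decreasing.
\<close>
lemma gram_diagonalization:
  fixes A :: "complex mat"
  assumes A: "A \<in> carrier_mat m n"
  obtains V d where "V \<in> carrier_mat n n" "mat_adjoint V * V = 1\<^sub>m n"
    "mat_adjoint (A * V) * (A * V) = diagonal n (\<lambda>i. of_real ((d i)\<^sup>2))"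
    "char_poly (mat_adjoint A * A) = (\<Prod>i\<leftarrow>[0..<n]. [:- of_real ((d i)\<^sup>2), 1:])"
    "antimono_on {..<n} d" "\<And>i. i < n \<Longrightarrow> 0 \<le> d i"
proof -
  define G where "G = mat_adjoint A * A"
  have A': "mat_adjoint A \<in> carrier_mat n m" using A by simp
  have G: "G \<in> carrier_mat n n" unfolding G_def by (rule mult_carrier_mat[OF A' A])
  have herm: "mat_adjoint G = G" unfolding G_def mat_adjoint_mult[OF A' A] by simp
  obtain es0 where es0: "char_poly G = (\<Prod>a\<leftarrow>es0. [:- a, 1:])" "length es0 = n"
    using char_poly_factorized[OF G] by blast
  define es where "es = rev (sort_key Re es0)"
  have len: "length es = n" by (simp add: es_def es0)
  have "mset (map (\<lambda>a. [:- a, 1:]) es) = mset (map (\<lambda>a. [:- a, 1:]) es0)"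
    by (simp add: es_def)
  then have cp: "char_poly G = (\<Prod>a\<leftarrow>es. [:- a, 1:])"
    unfolding es0(1) by (metis prod_mset_prod_list)
  obtain V where V: "V \<in> carrier_mat n n" and VV: "mat_adjoint V * V = 1\<^sub>m n"
    and D: "mat_adjoint V * G * V = diagonal n (\<lambda>i. es ! i)"
    using hermitian_unitarily_diagonalizable[OF G herm cp] by blast
  have V': "mat_adjoint V \<in> carrier_mat n n" using V by simp
  have AV: "A * V \<in> carrier_mat m n" using A V by simp
  have "mat_adjoint (A * V) * (A * V) = mat_adjoint V * (mat_adjoint A * (A * V))"
    unfolding mat_adjoint_mult[OF A V] by (rule assoc_mult_mat[OF V' A' AV])
  also have "mat_adjoint A * (A * V) = G * V"
    unfolding G_def by (rule assoc_mult_mat[OF A' A V, symmetric])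
  also have "mat_adjoint V * (G * V) = diagonal n (\<lambda>i. es ! i)"
    using D assoc_mult_mat[OF V' G V] by simp
  finally have AVAV: "mat_adjoint (A * V) * (A * V) = diagonal n (\<lambda>i. es ! i)" .
  define d where "d i = sqrt (Re (es ! i))" for i
  have es_nth: "es ! i = of_real (\<Sum>p<m. (cmod ((A * V) $$ (p, i)))\<^sup>2)" if "i < n" for i
    using index_adjoint_mult[OF AV AV that that] that
    unfolding AVAV cinner_self by (simp add: diagonal_def del: index_mult_mat)
  have d_sq: "of_real ((d i)\<^sup>2) = es ! i" and d_nonneg: "0 \<le> d i" if "i < n" for i
    by (simp_all only: d_def es_nth[OF that] Re_complex_of_real)
       (simp_all add: sum_nonneg del: index_mult_mat of_real_sum)
  have es_map: "es = map (\<lambda>i. of_real ((d i)\<^sup>2)) [0..<n]"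
    by (rule nth_equalityI) (use len d_sq in auto)
  show ?thesis
  proof (rule that[of V d])
    show "char_poly (mat_adjoint A * A) = (\<Prod>i\<leftarrow>[0..<n]. [:- of_real ((d i)\<^sup>2), 1:])"
      using cp unfolding G_def by (subst (asm) es_map) (simp add: comp_def)
    show "mat_adjoint (A * V) * (A * V) = diagonal n (\<lambda>i. of_real ((d i)\<^sup>2))"
      unfolding AVAV using d_sq by (auto simp: diagonal_def intro!: cong_mat)
    have "sorted (rev (map Re es))" by (simp add: es_def rev_map)
    then have "Re (es ! j) \<le> Re (es ! i)" if "i \<le> j" "j < n" for i j
      using that len by (auto simp: sorted_rev_iff_nth_mono)
    then show "antimono_on {..<n} d" by (auto simp: monotone_on_def d_def)
  qed (use V VV d_nonneg in auto)
qed

lemma antimono_positive_prefix: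
  fixes d :: "nat \<Rightarrow> real"
  assumes "antimono_on {..<n} d" "\<And>i. i < n \<Longrightarrow> 0 \<le> d i"
  obtains k where "k \<le> n" "\<And>i. i < k \<Longrightarrow> 0 < d i" "\<And>i. k \<le> i \<Longrightarrow> i < n \<Longrightarrow> d i = 0"
proof (cases "\<exists>i<n. d i = 0")
  case True
  define k where "k = (LEAST i. i < n \<and> d i = 0)"
  have k: "k < n" "d k = 0" using LeastI_ex[OF True] by (auto simp: k_def)
  have least: "0 < d i" if "i < k" for i
    using not_less_Least[of i "\<lambda>i. i < n \<and> d i = 0"] that k assms(2)[of i] by (auto simp: k_def)
  have "d i = 0" if "k \<le> i" "i < n" for i
    using assms(1) that k assms(2)[of i] by (force simp: monotone_on_def)
  with k least show ?thesis by (intro that[of k]) auto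
next
  case False
  with assms(2) show ?thesis by (intro that[of n]) (auto simp: order.order_iff_strict)
qed

text \<open>
  Multiplication by an invertible matrix on the right does not change the column space.
\<close>
lemma (in vec_space) rank_mult_invertible:
  assumes A: "A \<in> carrier_mat n nc" and P: "P \<in> carrier_mat nc nc" and Q: "Q \<in> carrier_mat nc nc"
    and PQ: "P * Q = 1\<^sub>m nc"
  shows "rank (A * P) = rank A"
proof -
  have AP: "A * P \<in> carrier_mat n nc" using A P by simp
  have "col_space (A * P) = col_space A"
  proof (rule equalityI; rule subsetI)
    fix y assume "y \<in> col_space (A * P)"
    then obtain x where x: "x \<in> carrier_vec nc" "y = (A * P) *\<^sub>v x"
      using AP A P by (auto simp: col_space_eq[OF AP])
    then have "y = A *\<^sub>v (P *\<^sub>v x)" using A P by simp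
    then show "y \<in> col_space A" using A P x by (auto simp: col_space_eq[OF A])
  next
    fix y assume "y \<in> col_space A"
    then obtain x where x: "x \<in> carrier_vec nc" "y = A *\<^sub>v x"
      using A by (auto simp: col_space_eq[OF A])
    have "(A * P) *\<^sub>v (Q *\<^sub>v x) = A *\<^sub>v ((P * Q) *\<^sub>v x)"
      using A P Q x by simp
    then have "y = (A * P) *\<^sub>v (Q *\<^sub>v x)" using x by (simp add: PQ)
    moreover have "Q *\<^sub>v x \<in> carrier_vec nc" using Q x by simp
    moreover have "y \<in> carrier_vec n" using x A by simp
    ultimately show "y \<in> col_space (A * P)" using AP A P by (auto simp: col_space_eq[OF AP])
  qed
  then show ?thesis by (simp add: rank_def col_space_def)
qed

lemma diagonal_gram_zero_column:
  fixes M :: "complex mat"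
  assumes M: "M \<in> carrier_mat m n" and MM: "mat_adjoint M * M = diagonal n f"
    and "i < n" "f i = 0" "p < m"
  shows "M $$ (p, i) = 0"
proof -
  have "cinner m (\<lambda>p. M $$ (p, i)) (\<lambda>p. M $$ (p, i)) = 0"
    using index_adjoint_mult[OF M M assms(3) assms(3)] assms by (simp add: MM diagonal_def)
  then have "(\<Sum>p<m. (cmod (M $$ (p, i)))\<^sup>2) = 0"
    unfolding cinner_self of_real_eq_0_iff .
  then show ?thesis using \<open>p < m\<close> by (subst (asm) sum_nonneg_eq_0_iff) auto
qed

text \<open>
  A diagonal Gram matrix means orthogonal columns. The first \<open>k\<close> columns are nonzero, hence linearly
  independent, and the others vanish, so the former are a maximal independent set of columns.
\<close>
lemma rank_orthogonal_columns:
  fixes M :: "complex mat"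
  assumes M: "M \<in> carrier_mat m n"
    and MM: "mat_adjoint M * M = diagonal n f"
    and "k \<le> n" and nz: "\<And>i. i < k \<Longrightarrow> f i \<noteq> 0" and zero: "\<And>i. k \<le> i \<Longrightarrow> i < n \<Longrightarrow> f i = 0"
  shows "vec_space.rank m M = k"
proof -
  interpret vec_space "TYPE(complex)" m .
  have ip: "cinner m (\<lambda>p. M $$ (p, j)) (\<lambda>p. M $$ (p, i)) = (if i = j then f i else 0)"
    if "i < n" "j < n" for i j
    using index_adjoint_mult[OF M M that] that by (simp add: MM diagonal_def)
  have zcol: "col M i = 0\<^sub>v m" if "k \<le> i" "i < n" for i
    using diagonal_gram_zero_column[OF M MM] zero[OF that] that M by (intro eq_vecI) auto
  define N where "N = mat m k (\<lambda>(p, i). M $$ (p, i))"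
  have N: "N \<in> carrier_mat m k" by (simp add: N_def)
  have colN: "col N i = col M i" if "i < k" for i
    using that M \<open>k \<le> n\<close> by (intro eq_vecI) (auto simp: N_def)
  have ipN: "cinner m (\<lambda>p. N $$ (p, j)) (\<lambda>p. N $$ (p, i)) = (if i = j then f i else 0)"
    if "i < k" "j < k" for i j
    using ip[of i j] that \<open>k \<le> n\<close> by (simp add: N_def cinner_def)
  have dist: "distinct (cols N)"
  proof (unfold distinct_conv_nth, intro allI impI)
    fix i j assume "i < length (cols N)" "j < length (cols N)" "i \<noteq> j"
    then have ij: "i < k" "j < k" "i \<noteq> j" using N by auto
    show "cols N ! i \<noteq> cols N ! j"
    proof
      assume "cols N ! i = cols N ! j"
      then have c: "col N i = col N j" using ij N by simp
      have "N $$ (p, i) = N $$ (p, j)" if "p < m" for p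
        using arg_cong[OF c, of "\<lambda>v. v $ p"] ij N that by simp
      then have "cinner m (\<lambda>p. N $$ (p, i)) (\<lambda>p. N $$ (p, i))
          = cinner m (\<lambda>p. N $$ (p, j)) (\<lambda>p. N $$ (p, i))" by (simp add: cinner_def)
      then show False using ipN ij nz by simp
    qed
  qed
  have indep: "lin_indpt (set (cols N))"
  proof
    assume "lin_dep (set (cols N))"
    from lin_depE[OF N this dist] obtain v where v: "v \<in> carrier_vec k" "v \<noteq> 0\<^sub>v k" "N *\<^sub>v v = 0\<^sub>v m"
      by blast
    have Nv: "(N *\<^sub>v v) $ p = (\<Sum>j<k. N $$ (p, j) * v $ j)" if "p < m" for p
      using N v(1) that by (simp add: scalar_prod_def lessThan_atLeast0)
    \<comment> \<open>Pairing the relation \<open>N v = 0\<close> with column \<open>i\<close> isolates the coefficient \<open>v $ i\<close>.\<close>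
    have "v $ i = 0" if i: "i < k" for i
    proof -
      have "0 = (\<Sum>p<m. (N *\<^sub>v v) $ p * cnj (N $$ (p, i)))" by (simp add: v)
      also have "\<dots> = (\<Sum>p<m. \<Sum>j<k. v $ j * (N $$ (p, j) * cnj (N $$ (p, i))))"
        by (intro sum.cong) (auto simp: Nv sum_distrib_left sum_distrib_right mult_ac)
      also have "\<dots> = (\<Sum>j<k. v $ j * cinner m (\<lambda>p. N $$ (p, j)) (\<lambda>p. N $$ (p, i)))"
        by (subst sum.swap) (simp add: cinner_def sum_distrib_left)
      also have "\<dots> = (\<Sum>j<k. if i = j then v $ j * f i else 0)"
        using i by (intro sum.cong) (auto simp: ipN)
      also have "\<dots> = v $ i * f i" using i by simp
      finally show ?thesis using nz[OF i] by simp
    qed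
    then have "v = 0\<^sub>v k" using v by (intro eq_vecI) auto
    then show False using v by simp
  qed
  have setN: "set (cols N) = col M ` {..<k}"
  proof -
    have "set (cols N) = col N ` {..<k}" using N by (auto simp: cols_def)
    also have "\<dots> = col M ` {..<k}" using colN by (intro image_cong) auto
    finally show ?thesis .
  qed
  have setM: "set (cols M) \<subseteq> insert (0\<^sub>v m) (set (cols N))" "set (cols N) \<subseteq> set (cols M)"
  proof -
    have "set (cols M) = col M ` {..<n}" using M by (auto simp: cols_def)
    then show "set (cols M) \<subseteq> insert (0\<^sub>v m) (set (cols N))" "set (cols N) \<subseteq> set (cols M)"
      unfolding setN using zcol \<open>k \<le> n\<close> by (auto simp: not_less[symmetric])
  qed
  have "maximal (set (cols N)) (\<lambda>T. T \<subseteq> set (cols M) \<and> lin_indpt T)"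
    unfolding maximal_def
  proof (intro conjI allI impI indep setM(2))
    fix T assume T: "set (cols N) \<subseteq> T \<and> T \<subseteq> set (cols M) \<and> lin_indpt T"
    have "T \<subseteq> carrier_vec m" using T cols_dim[of M] M by auto
    moreover have "(UNIV :: complex set) \<noteq> {0}" by (metis UNIV_I singletonD zero_neq_one)
    ultimately have "0\<^sub>v m \<notin> T" using T zero_nin_lin_indpt[of T] by (auto simp: class_ring_simps)
    then show "T = set (cols N)" using T setM(1) by blast
  qed
  from rank_card_indpt[OF M this] have "rank M = card (set (cols N))" .
  also have "\<dots> = k" using distinct_card[OF dist] N by simp
  finally show ?thesis .
qed

section \<open>Thin singular value decomposition\<close>

text \<open>
  \<open>A = \<Sum> d i \<cdot> u i \<cdot> (v i)\<^sup>*\<close> with orthonormal left and right singular vectors. Only the nonzero singular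
  values occur, so no convention is needed for completing the two families to bases.
\<close>
definition thin_svd ::
  "nat \<Rightarrow> nat \<Rightarrow> nat \<Rightarrow> (nat \<Rightarrow> real) \<Rightarrow> (nat \<Rightarrow> nat \<Rightarrow> complex) \<Rightarrow> (nat \<Rightarrow> nat \<Rightarrow> complex) \<Rightarrow>
    complex mat \<Rightarrow> bool" where
  "thin_svd m n k d u v A \<longleftrightarrow>
     A \<in> carrier_mat m n \<and> orthonormal m k u \<and> orthonormal n k v \<and>
     antimono_on {..<k} d \<and> (\<forall>i<k. 0 < d i) \<and>
     (\<forall>p<m. \<forall>q<n. A $$ (p, q) = (\<Sum>i<k. of_real (d i) * u i p * cnj (v i q)))"

text \<open>
  With \<open>V\<close> unitary and \<open>A V\<close> having orthogonal columns of norms \<open>d i\<close>, the left singular vectors are the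
  normalized nonzero columns, and \<open>A = (A V) V\<^sup>*\<close> is the decomposition. The rank of \<open>A\<close> is that of \<open>A V\<close>,
  namely the number of nonzero columns.
\<close>
lemma ex_thin_svd:
  fixes A :: "complex mat"
  assumes A: "A \<in> carrier_mat m n"
  obtains d u v where "thin_svd m n (vec_space.rank m A) d u v A"
    "nonzero_singular_values A = map d [0..<vec_space.rank m A]"
proof -
  obtain V d where V: "V \<in> carrier_mat n n" and VV: "mat_adjoint V * V = 1\<^sub>m n"
    and MM: "mat_adjoint (A * V) * (A * V) = diagonal n (\<lambda>i. of_real ((d i)\<^sup>2))"
    and cp: "char_poly (mat_adjoint A * A) = (\<Prod>i\<leftarrow>[0..<n]. [:- of_real ((d i)\<^sup>2), 1:])"
    and anti: "antimono_on {..<n} d" and nonneg: "\<And>i. i < n \<Longrightarrow> 0 \<le> d i"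
    using gram_diagonalization[OF A] by metis
  obtain k where k: "k \<le> n" and pos: "\<And>i. i < k \<Longrightarrow> 0 < d i"
    and zero: "\<And>i. k \<le> i \<Longrightarrow> i < n \<Longrightarrow> d i = 0"
    using antimono_positive_prefix[OF anti nonneg] by metis
  define M where "M = A * V"
  note MM = MM[folded M_def]
  have M: "M \<in> carrier_mat m n" using A V by (simp add: M_def)
  have V': "mat_adjoint V \<in> carrier_mat n n" using V by simp
  have VV': "V * mat_adjoint V = 1\<^sub>m n" by (rule mat_mult_left_right_inverse[OF V' V VV])
  have "vec_space.rank m M = vec_space.rank m A"
    unfolding M_def by (rule vec_space.rank_mult_invertible[OF A V V' VV'])
  moreover have "vec_space.rank m M = k"
    by (rule rank_orthogonal_columns[OF M MM k]) (use pos zero in force)+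
  ultimately have rank: "vec_space.rank m A = k" by simp
  define u where "u i p = M $$ (p, i) / of_real (d i)" for i p
  define v where "v i q = V $$ (q, i)" for i q
  have v: "orthonormal n k v"
    unfolding orthonormal_def
  proof (intro allI impI)
    fix i j assume "i < k" "j < k"
    then have "cinner n (v i) (v j) = 1\<^sub>m n $$ (j, i)"
      using index_adjoint_mult[OF V V, of j i] k unfolding VV v_def[abs_def] by simp
    then show "cinner n (v i) (v j) = of_bool (i = j)" using \<open>i < k\<close> \<open>j < k\<close> k by simp
  qed
  have u: "orthonormal m k u"
    unfolding orthonormal_def
  proof (intro allI impI)
    fix i j assume ij: "i < k" "j < k"
    then have "cinner m (\<lambda>p. M $$ (p, i)) (\<lambda>p. M $$ (p, j)) =
        diagonal n (\<lambda>i. of_real ((d i)\<^sup>2)) $$ (j, i)"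
      using index_adjoint_mult[OF M M, of j i] k unfolding MM by simp
    then have gram: "cinner m (\<lambda>p. M $$ (p, i)) (\<lambda>p. M $$ (p, j)) =
        (if i = j then of_real ((d i)\<^sup>2) else 0)"
      using ij k by (auto simp: diagonal_def)
    have "cinner m (u i) (u j) =
        cinner m (\<lambda>p. M $$ (p, i)) (\<lambda>p. M $$ (p, j)) / (of_real (d i) * of_real (d j))"
      by (simp add: cinner_def u_def sum_divide_distrib)
    also have "\<dots> = of_bool (i = j)"
      using pos[OF ij(1)] by (auto simp: gram power2_eq_square)
    finally show "cinner m (u i) (u j) = of_bool (i = j)" .
  qed
  have entries: "A $$ (p, q) = (\<Sum>i<k. of_real (d i) * u i p * cnj (v i q))" if "p < m" "q < n" for p q
  proof -
    have "A = M * mat_adjoint V"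
      unfolding M_def using assoc_mult_mat[OF A V V'] A by (simp add: VV')
    then have "A $$ (p, q) = (\<Sum>i<n. M $$ (p, i) * cnj (V $$ (q, i)))"
      using M V that by (simp add: scalar_prod_def index_mat_adjoint lessThan_atLeast0)
    also have "\<dots> = (\<Sum>i<k. M $$ (p, i) * cnj (V $$ (q, i)))"
      using k zero diagonal_gram_zero_column[OF M MM] that
      by (intro sum.mono_neutral_right) (auto simp: not_less)
    also have "\<dots> = (\<Sum>i<k. of_real (d i) * u i p * cnj (v i q))"
      using pos by (intro sum.cong) (auto simp: u_def v_def less_imp_neq[symmetric])
    finally show ?thesis .
  qed
  show ?thesis
  proof (rule that[of d u v])
    show "nonzero_singular_values A = map d [0..<vec_space.rank m A]"
      unfolding rank by (rule nonzero_singular_values_eqI[OF cp anti pos zero k])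
    have "antimono_on {..<k} d" by (rule monotone_on_subset[OF anti]) (use k in auto)
    then show "thin_svd m n (vec_space.rank m A) d u v A"
      unfolding rank thin_svd_def using A u v pos entries by blast
  qed
qed

section \<open>Von Neumann's trace inequality\<close>

lemma cinner_sum_sum:
  "cinner N (\<lambda>p. \<Sum>i<k. a i * u i p) (\<lambda>p. \<Sum>j<l. b j * x j p) =
     (\<Sum>i<k. \<Sum>j<l. a i * cnj (b j) * cinner N (u i) (x j))"
proof -
  have "cinner N (\<lambda>p. \<Sum>i<k. a i * u i p) (\<lambda>p. \<Sum>j<l. b j * x j p) =
      (\<Sum>p<N. \<Sum>i<k. \<Sum>j<l. a i * cnj (b j) * (u i p * cnj (x j p)))"
    unfolding cinner_def by (intro sum.cong) (auto simp: sum_product mult_ac intro!: sum.cong)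
  also have "\<dots> = (\<Sum>i<k. \<Sum>p<N. \<Sum>j<l. a i * cnj (b j) * (u i p * cnj (x j p)))"
    by (rule sum.swap)
  also have "\<dots> = (\<Sum>i<k. \<Sum>j<l. \<Sum>p<N. a i * cnj (b j) * (u i p * cnj (x j p)))"
    by (rule sum.cong[OF refl], rule sum.swap)
  finally show ?thesis by (simp add: cinner_def sum_distrib_left)
qed

lemma mat_trace_adjoint_mult:
  assumes "A \<in> carrier_mat m n" "B \<in> carrier_mat m n"
  shows "mat_trace (mat_adjoint B * A) = (\<Sum>q<n. cinner m (\<lambda>p. A $$ (p, q)) (\<lambda>p. B $$ (p, q)))"
  unfolding mat_trace_def using assms index_adjoint_mult[OF assms(2,1)]
  by (intro sum.cong) (auto simp del: index_mult_mat(1))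

text \<open>
  The trace as a form in the two sequences of singular values; the coefficients are products of
  overlaps between left and between right singular vectors.
\<close>
lemma mat_trace_thin_svd:
  assumes A: "thin_svd m n k d u v A" and B: "thin_svd m n l t x y B"
  shows "mat_trace (mat_adjoint B * A) =
    (\<Sum>i<k. \<Sum>j<l. of_real (d i * t j) * (cinner m (u i) (x j) * cinner n (y j) (v i)))"
proof -
  have Ac: "A \<in> carrier_mat m n" and Bc: "B \<in> carrier_mat m n"
    using A B by (auto simp: thin_svd_def)
  have col: "cinner m (\<lambda>p. A $$ (p, q)) (\<lambda>p. B $$ (p, q)) =
      (\<Sum>i<k. \<Sum>j<l. of_real (d i * t j) * (cinner m (u i) (x j) * (y j q * cnj (v i q))))"
    if "q < n" for q
  proof -
    have "cinner m (\<lambda>p. A $$ (p, q)) (\<lambda>p. B $$ (p, q)) =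
        cinner m (\<lambda>p. \<Sum>i<k. (of_real (d i) * cnj (v i q)) * u i p)
          (\<lambda>p. \<Sum>j<l. (of_real (t j) * cnj (y j q)) * x j p)"
      unfolding cinner_def using A B that
      by (intro sum.cong) (auto simp: thin_svd_def mult_ac)
    also have "\<dots> = (\<Sum>i<k. \<Sum>j<l. of_real (d i * t j) * (cinner m (u i) (x j) * (y j q * cnj (v i q))))"
      unfolding cinner_sum_sum by (simp add: mult_ac)
    finally show ?thesis .
  qed
  have "mat_trace (mat_adjoint B * A) =
      (\<Sum>q<n. \<Sum>i<k. \<Sum>j<l. of_real (d i * t j) * (cinner m (u i) (x j) * (y j q * cnj (v i q))))"
    unfolding mat_trace_adjoint_mult[OF Ac Bc] by (intro sum.cong) (auto simp: col)
  also have "\<dots> = (\<Sum>i<k. \<Sum>q<n. \<Sum>j<l. of_real (d i * t j) * (cinner m (u i) (x j) * (y j q * cnj (v i q))))"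
    by (rule sum.swap)
  also have "\<dots> = (\<Sum>i<k. \<Sum>j<l. \<Sum>q<n. of_real (d i * t j) * (cinner m (u i) (x j) * (y j q * cnj (v i q))))"
    by (rule sum.cong[OF refl], rule sum.swap)
  finally show ?thesis by (simp add: cinner_def sum_distrib_left)
qed

text \<open>
  The squared Frobenius norm is the trace of \<open>A\<^sup>* A\<close>, in which all overlaps are Kronecker deltas.
\<close>
lemma frobenius_norm_thin_svd:
  assumes A: "thin_svd m n k d u v A"
  shows "frobenius_norm A = sqrt (\<Sum>i<k. (d i)\<^sup>2)"
proof -
  have Ac: "A \<in> carrier_mat m n" using A by (simp add: thin_svd_def)
  have "mat_trace (mat_adjoint A * A) = of_real (\<Sum>q<n. \<Sum>p<m. (cmod (A $$ (p, q)))\<^sup>2)"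
    by (simp only: mat_trace_adjoint_mult[OF Ac Ac] cinner_self of_real_sum)
  also have "(\<Sum>q<n. \<Sum>p<m. (cmod (A $$ (p, q)))\<^sup>2) = (\<Sum>p<m. \<Sum>q<n. (cmod (A $$ (p, q)))\<^sup>2)"
    by (rule sum.swap)
  also have "mat_trace (mat_adjoint A * A) = (\<Sum>i<k. \<Sum>j<k. if i = j then of_real ((d i)\<^sup>2) else 0)"
    unfolding mat_trace_thin_svd[OF A A] using A
    by (intro sum.cong) (auto simp: thin_svd_def orthonormal_def power2_eq_square)
  also have "\<dots> = of_real (\<Sum>i<k. (d i)\<^sup>2)" by simp
  finally have "(\<Sum>p<m. \<Sum>q<n. (cmod (A $$ (p, q)))\<^sup>2) = (\<Sum>i<k. (d i)\<^sup>2)"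
    unfolding of_real_eq_iff by simp
  then show ?thesis using Ac by (simp add: frobenius_norm_def)
qed

lemma cmod_cinner_commute: "cmod (cinner N f g) = cmod (cinner N g f)"
  by (metis cnj_cinner complex_mod_cnj)

lemma orthonormal_sum_cmod:
  assumes "orthonormal N k u" "i < k"
  shows "(\<Sum>p<N. (cmod (u i p))\<^sup>2) = 1"
proof -
  have "complex_of_real (\<Sum>p<N. (cmod (u i p))\<^sup>2) = of_real 1"
    using assms by (simp only: cinner_self[symmetric]) (simp add: orthonormal_def)
  then show ?thesis unfolding of_real_eq_iff .
qed

text \<open>
  The overlaps \<open>w i j\<close> and \<open>z i j\<close> satisfy \<open>|w i j| |z i j| \<le> p i j\<close>, where \<open>p i j\<close> is the mean of
  \<open>|w i j|\<^sup>2\<close> and \<open>|z i j|\<^sup>2\<close>. Bessel's inequality for each of the four orthonormal families makes \<open>p\<close>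
  doubly substochastic.
\<close>
lemma von_neumann_trace_inequality:
  assumes A: "thin_svd m n r \<sigma> u v A" and B: "thin_svd m n s \<tau> x y B" and "r \<le> s"
  shows "cmod (mat_trace (mat_adjoint B * A)) \<le> (\<Sum>i<r. \<sigma> i * \<tau> i)"
proof -
  define w where "w i j = cinner m (u i) (x j)" for i j
  define z where "z i j = cinner n (y j) (v i)" for i j
  define p where "p i j = ((cmod (w i j))\<^sup>2 + (cmod (z i j))\<^sup>2) / 2" for i j
  have ortho: "orthonormal m r u" "orthonormal n r v" "orthonormal m s x" "orthonormal n s y"
    using A B by (auto simp: thin_svd_def)
  have pos: "i < r \<Longrightarrow> 0 < \<sigma> i" "j < s \<Longrightarrow> 0 < \<tau> j" for i j
    using A B by (auto simp: thin_svd_def)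
  have "cmod (mat_trace (mat_adjoint B * A)) =
      cmod (\<Sum>i<r. \<Sum>j<s. of_real (\<sigma> i * \<tau> j) * (w i j * z i j))"
    by (simp only: mat_trace_thin_svd[OF A B] w_def z_def)
  also have "\<dots> \<le> (\<Sum>i<r. \<Sum>j<s. cmod (of_real (\<sigma> i * \<tau> j) * (w i j * z i j)))"
    by (intro order.trans[OF norm_sum] sum_mono norm_sum)
  also have "\<dots> \<le> (\<Sum>i<r. \<Sum>j<s. \<sigma> i * \<tau> j * p i j)"
  proof (intro sum_mono)
    fix i j assume "i \<in> {..<r}" "j \<in> {..<s}"
    then have "0 \<le> \<sigma> i * \<tau> j" using pos(1)[of i] pos(2)[of j] by simp
    moreover have "cmod (w i j) * cmod (z i j) \<le> p i j"
      using sum_squares_bound[of "cmod (w i j)" "cmod (z i j)"] by (simp add: p_def)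
    ultimately show "cmod (of_real (\<sigma> i * \<tau> j) * (w i j * z i j)) \<le> \<sigma> i * \<tau> j * p i j"
      unfolding norm_mult norm_of_real by (simp add: mult_left_mono)
  qed
  also have "\<dots> \<le> (\<Sum>i<r. \<sigma> i * \<tau> i)"
  proof (rule doubly_substochastic_sum_le)
    fix i assume i: "i < r"
    have "(\<Sum>j<s. (cmod (w i j))\<^sup>2) \<le> 1"
      using bessel[OF ortho(3), of "u i"] orthonormal_sum_cmod[OF ortho(1) i] by (simp add: w_def)
    moreover have "(\<Sum>j<s. (cmod (z i j))\<^sup>2) \<le> 1"
      using bessel[OF ortho(4), of "v i"] orthonormal_sum_cmod[OF ortho(2) i]
      by (simp add: z_def cmod_cinner_commute[of n _ "v i"])
    ultimately show "(\<Sum>j<s. p i j) \<le> 1"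
      by (simp add: p_def sum.distrib flip: sum_divide_distrib)
  next
    fix j assume j: "j < s"
    have "(\<Sum>i<r. (cmod (w i j))\<^sup>2) \<le> 1"
      using bessel[OF ortho(1), of "x j"] orthonormal_sum_cmod[OF ortho(3) j]
      by (simp add: w_def cmod_cinner_commute[of m _ "x j"])
    moreover have "(\<Sum>i<r. (cmod (z i j))\<^sup>2) \<le> 1"
      using bessel[OF ortho(2), of "y j"] orthonormal_sum_cmod[OF ortho(4) j] by (simp add: z_def)
    ultimately show "(\<Sum>i<r. p i j) \<le> 1"
      by (simp add: p_def sum.distrib flip: sum_divide_distrib)
  qed (use A B pos \<open>r \<le> s\<close> in \<open>auto simp: thin_svd_def p_def intro: less_imp_le\<close>)
  finally show ?thesis .
qed

section \<open>Rectangular diagonal matrices\<close>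

definition rect_diagonal :: "nat \<Rightarrow> nat \<Rightarrow> nat \<Rightarrow> (nat \<Rightarrow> real) \<Rightarrow> complex mat" where
  "rect_diagonal m n k f = mat m n (\<lambda>(i, j). if i = j \<and> i < k then of_real (f i) else 0)"

lemma orthonormal_unit:
  assumes "k \<le> N"
  shows "orthonormal N k (\<lambda>i p. of_bool (p = i))"
  unfolding orthonormal_def
proof (intro allI impI)
  fix i j assume "i < k" "j < k"
  have "cinner N (\<lambda>p. of_bool (p = i)) (\<lambda>p. of_bool (p = j)) = (\<Sum>p<N. if p = i then of_bool (i = j) else 0)"
    unfolding cinner_def by (intro sum.cong) auto
  also have "\<dots> = of_bool (i = j)" using \<open>i < k\<close> assms by simp
  finally show "cinner N (\<lambda>p. of_bool (p = i)) (\<lambda>p. of_bool (p = j)) = of_bool (i = j)" .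
qed

lemma thin_svd_rect_diagonal:
  assumes "k \<le> min m n" "antimono_on {..<k} f" "\<forall>i<k. 0 < f i"
  shows "thin_svd m n k f (\<lambda>i p. of_bool (p = i)) (\<lambda>i q. of_bool (q = i)) (rect_diagonal m n k f)"
  unfolding thin_svd_def
proof (intro conjI allI impI)
  fix p q assume "p < m" "q < n"
  have "(\<Sum>i<k. of_real (f i) * of_bool (p = i) * cnj (of_bool (q = i))) =
      (\<Sum>i<k. if i = p then (if p = q then complex_of_real (f p) else 0) else 0)"
    by (intro sum.cong) auto
  then show "rect_diagonal m n k f $$ (p, q) =
      (\<Sum>i<k. of_real (f i) * of_bool (p = i) * cnj (of_bool (q = i)))"
    using \<open>p < m\<close> \<open>q < n\<close> by (auto simp: rect_diagonal_def)
qed (use assms in \<open>auto simp: rect_diagonal_def intro: orthonormal_unit\<close>)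

lemma rect_diagonal_rank_and_singular_values:
  assumes k: "k \<le> min m n" and anti: "antimono_on {..<k} f" and pos: "\<forall>i<k. 0 < f i"
  shows "rect_diagonal m n k f \<in> rank_mats m n k"
    and "nonzero_singular_values (rect_diagonal m n k f) = map f [0..<k]"
proof -
  define R where "R = rect_diagonal m n k f"
  define d where "d i = (if i < k then f i else 0)" for i
  have R: "R \<in> carrier_mat m n" by (simp add: R_def rect_diagonal_def)
  have gram: "mat_adjoint R * R = diagonal n (\<lambda>i. of_real ((d i)\<^sup>2))"
  proof (rule eq_matI)
    fix i j
    assume "i < dim_row (diagonal n (\<lambda>i. of_real ((d i)\<^sup>2)))"
      "j < dim_col (diagonal n (\<lambda>i. of_real ((d i)\<^sup>2)))"
    then have ij: "i < n" "j < n" by (auto simp: diagonal_def)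
    have "(mat_adjoint R * R) $$ (i, j) = cinner m (\<lambda>p. R $$ (p, j)) (\<lambda>p. R $$ (p, i))"
      by (rule index_adjoint_mult[OF R R ij])
    also have "\<dots> = (\<Sum>p<m. if p = i then (if i = j then of_real ((d i)\<^sup>2) else 0) else 0)"
      unfolding cinner_def using ij
      by (intro sum.cong) (auto simp: R_def rect_diagonal_def d_def power2_eq_square)
    also have "\<dots> = diagonal n (\<lambda>i. of_real ((d i)\<^sup>2)) $$ (i, j)"
      using ij k by (auto simp: diagonal_def d_def)
    finally show "(mat_adjoint R * R) $$ (i, j) = diagonal n (\<lambda>i. of_real ((d i)\<^sup>2)) $$ (i, j)" .
  qed (use R in \<open>auto simp: diagonal_def\<close>)
  have "vec_space.rank m R = k"
    by (rule rank_orthogonal_columns[OF R gram]) (use k pos in \<open>force simp: d_def\<close>)+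
  then show "rect_diagonal m n k f \<in> rank_mats m n k" using R by (simp add: rank_mats_def R_def)
  have "char_poly (mat_adjoint R * R) = (\<Prod>a\<leftarrow>diag_mat (mat_adjoint R * R). [:- a, 1:])"
    by (rule char_poly_upper_triangular[of _ n]) (auto simp: gram diagonal_def)
  also have "diag_mat (mat_adjoint R * R) = map (\<lambda>i. of_real ((d i)\<^sup>2)) [0..<n]"
    by (auto simp: gram diag_mat_def diagonal_def)
  finally have "nonzero_singular_values R = map d [0..<k]"
    using anti pos k
    by (intro nonzero_singular_values_eqI[where n = n])
      (auto simp: comp_def d_def monotone_on_def less_imp_le)
  then show "nonzero_singular_values (rect_diagonal m n k f) = map f [0..<k]"
    by (simp add: R_def d_def)
qed

section \<open>The inequality and its optimality\<close>

text \<open>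
  Translates from positions counted from one to positions counted from zero.
\<close>
lemma trace_coeff_altdef:
  assumes "\<And>i. i < r \<Longrightarrow> \<sigma> (Suc i) = f i" "\<And>i. i < s \<Longrightarrow> \<tau> (Suc i) = g i" "r \<le> s"
  shows "trace_coeff r s \<sigma> \<tau> =
    (\<Sum>i<r. f i * g i) / (sqrt (\<Sum>i<r. (f i)\<^sup>2) * sqrt (\<Sum>i<s. (g i)\<^sup>2))"
  using assms by (simp add: trace_coeff_def sum.atLeast1_atMost_eq)

theorem theorem1p20:
  fixes m n r s :: nat
  assumes "1 \<le> r" and "r \<le> s"
  shows "(\<forall>A \<in> rank_mats m n r. \<forall>B \<in> rank_mats m n s.
            cmod (mat_trace (mat_adjoint B * A))
              \<le> trace_coeff r s (nonzero_singular_value A) (nonzero_singular_value B)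
                 * (frobenius_norm A * frobenius_norm B))
       \<and> (\<forall>\<sigma> \<tau> :: nat \<Rightarrow> real. \<forall>c :: real.
            s \<le> min m n
            \<longrightarrow> antimono_on {1..r} \<sigma> \<longrightarrow> (\<forall>j\<in>{1..r}. 0 < \<sigma> j)
            \<longrightarrow> antimono_on {1..s} \<tau> \<longrightarrow> (\<forall>j\<in>{1..s}. 0 < \<tau> j)
            \<longrightarrow> c < trace_coeff r s \<sigma> \<tau>
            \<longrightarrow> \<not> (\<forall>A \<in> rank_mats m n r. \<forall>B \<in> rank_mats m n s.
                    nonzero_singular_values A = map \<sigma> [1..<Suc r]
                    \<longrightarrow> nonzero_singular_values B = map \<tau> [1..<Suc s]
                    \<longrightarrow> cmod (mat_trace (mat_adjoint B * A))
                          \<le> c * (frobenius_norm A * frobenius_norm B)))"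
proof -
  have norm_pos: "0 < frobenius_norm A" if "thin_svd m n k d u v A" "1 \<le> k" for k d u v A
  proof -
    have "0 \<in> {..<k}" using that(2) by simp
    then have "0 < (\<Sum>i<k. (d i)\<^sup>2)"
      using that(1) by (intro sum_pos) (auto simp: thin_svd_def)
    then show ?thesis unfolding frobenius_norm_thin_svd[OF that(1)] by simp
  qed
  show ?thesis
  proof (intro conjI ballI allI impI)
    fix A B assume A: "A \<in> rank_mats m n r" and B: "B \<in> rank_mats m n s"
    from ex_thin_svd[of A m n] obtain f u v where
      svdA: "thin_svd m n r f u v A" and nsvA: "nonzero_singular_values A = map f [0..<r]"
      using A by (auto simp: rank_mats_def)
    from ex_thin_svd[of B m n] obtain g x y where
      svdB: "thin_svd m n s g x y B" and nsvB: "nonzero_singular_values B = map g [0..<s]"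
      using B by (auto simp: rank_mats_def)
    have "cmod (mat_trace (mat_adjoint B * A)) \<le> (\<Sum>i<r. f i * g i)"
      by (rule von_neumann_trace_inequality[OF svdA svdB \<open>r \<le> s\<close>])
    also have "\<dots> = trace_coeff r s (nonzero_singular_value A) (nonzero_singular_value B)
        * (frobenius_norm A * frobenius_norm B)"
    proof -
      have "trace_coeff r s (nonzero_singular_value A) (nonzero_singular_value B) =
          (\<Sum>i<r. f i * g i) / (frobenius_norm A * frobenius_norm B)"
        unfolding frobenius_norm_thin_svd[OF svdA] frobenius_norm_thin_svd[OF svdB]
        by (rule trace_coeff_altdef)
          (use \<open>r \<le> s\<close> in \<open>auto simp: nonzero_singular_value_def nsvA nsvB\<close>)
      then show ?thesis
        using norm_pos[OF svdA] norm_pos[OF svdB] \<open>1 \<le> r\<close> \<open>r \<le> s\<close> by simp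
    qed
    finally show "cmod (mat_trace (mat_adjoint B * A))
      \<le> trace_coeff r s (nonzero_singular_value A) (nonzero_singular_value B)
         * (frobenius_norm A * frobenius_norm B)" .
  next
    fix \<sigma> \<tau> :: "nat \<Rightarrow> real" and c :: real
    assume s: "s \<le> min m n"
      and \<sigma>: "antimono_on {1..r} \<sigma>" "\<forall>j\<in>{1..r}. 0 < \<sigma> j"
      and \<tau>: "antimono_on {1..s} \<tau>" "\<forall>j\<in>{1..s}. 0 < \<tau> j"
      and c: "c < trace_coeff r s \<sigma> \<tau>"
    define f where "f i = \<sigma> (Suc i)" for i
    define g where "g i = \<tau> (Suc i)" for i
    have r: "r \<le> min m n" using s \<open>r \<le> s\<close> by simp
    have f: "antimono_on {..<r} f" "\<forall>i<r. 0 < f i"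
      using \<sigma> by (auto simp: f_def monotone_on_def)
    have g: "antimono_on {..<s} g" "\<forall>i<s. 0 < g i"
      using \<tau> by (auto simp: g_def monotone_on_def)
    \<comment> \<open>The standard unit vectors are common singular vectors of these two matrices, so the overlap
        arrays are identities and the trace attains its bound.\<close>
    define A where "A = rect_diagonal m n r f"
    define B where "B = rect_diagonal m n s g"
    note A = rect_diagonal_rank_and_singular_values[OF r f, folded A_def]
    note B = rect_diagonal_rank_and_singular_values[OF s g, folded B_def]
    note svdA = thin_svd_rect_diagonal[OF r f, folded A_def]
    note svdB = thin_svd_rect_diagonal[OF s g, folded B_def]
    have shift: "map h [1..<Suc k] = map (\<lambda>i. h (Suc i)) [0..<k]" for h :: "nat \<Rightarrow> real" and k
    proof -
      have "[1..<Suc k] = map Suc [0..<k]" by (simp only: map_Suc_upt One_nat_def)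
      then show ?thesis by (simp only: map_map comp_def)
    qed
    have nsv: "nonzero_singular_values A = map \<sigma> [1..<Suc r]"
      "nonzero_singular_values B = map \<tau> [1..<Suc s]"
      unfolding shift using A B by (simp_all add: f_def[abs_def] g_def[abs_def])
    have delta: "cinner N (\<lambda>p. of_bool (p = i)) (\<lambda>p. of_bool (p = j)) = of_bool (i = j)"
      if "i < s" "j < s" "s \<le> N" for N i j
      using orthonormal_unit[of s N] that unfolding orthonormal_def by blast
    have "mat_trace (mat_adjoint B * A) =
        (\<Sum>i<r. \<Sum>j<s. if i = j then of_real (f i * g i) else 0)"
      unfolding mat_trace_thin_svd[OF svdA svdB] using s \<open>r \<le> s\<close>
      by (intro sum.cong) (auto simp: delta)
    also have "\<dots> = (\<Sum>i<r. of_real (f i * g i))"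
      using \<open>r \<le> s\<close> by (intro sum.cong) auto
    finally have tr: "mat_trace (mat_adjoint B * A) = of_real (\<Sum>i<r. f i * g i)" by simp
    have pos: "0 < frobenius_norm A * frobenius_norm B"
      using norm_pos[OF svdA] norm_pos[OF svdB] \<open>1 \<le> r\<close> \<open>r \<le> s\<close> by simp
    have "trace_coeff r s \<sigma> \<tau> = (\<Sum>i<r. f i * g i) / (frobenius_norm A * frobenius_norm B)"
      unfolding frobenius_norm_thin_svd[OF svdA] frobenius_norm_thin_svd[OF svdB]
      by (rule trace_coeff_altdef) (use \<open>r \<le> s\<close> in \<open>auto simp: f_def g_def\<close>)
    with c pos have "c * (frobenius_norm A * frobenius_norm B) < (\<Sum>i<r. f i * g i)"
      by (simp add: pos_less_divide_eq)
    also have "\<dots> \<le> cmod (mat_trace (mat_adjoint B * A))"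
      unfolding tr norm_of_real by simp
    finally show "\<not> (\<forall>A \<in> rank_mats m n r. \<forall>B \<in> rank_mats m n s.
        nonzero_singular_values A = map \<sigma> [1..<Suc r]
        \<longrightarrow> nonzero_singular_values B = map \<tau> [1..<Suc s]
        \<longrightarrow> cmod (mat_trace (mat_adjoint B * A)) \<le> c * (frobenius_norm A * frobenius_norm B))"
      using A(1) B(1) nsv by (meson leD)
  qed
qed

end
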